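(* $\mathsf{OG\mapsto\alpha0}\not\leq_{\mathsf{W}}\mathsf{C}_{\mathbb{N}}$, where $\mathsf{OG\mapsto\alpha0}$ is the problem which, given a countable ordered group $(G,\leq)$ whose order type is $\mathbb{Z}^{\alpha}$ for some ordinal $\alpha$, outputs a copy of $\alpha$.
   Context: Weihrauch reducibility: a represented space is a set $X$ with a partial surjection $\delta_X:\subseteq\mathbb{N}^{\mathbb{N}}\to X$; if $\delta_X(p)=x$, $p$ is a name of $x$. A problem is a partial multi-valued function between represented spaces. $f\leq_{\mathsf{W}}g$ iff there are computable partial functions $\Phi,\Psi$ on Baire space such that whenever $p$ is a name of some $x\in\mathrm{dom}(f)$, $\Phi(p)$ is a name of some $z\in\mathrm{dom}(g)$, and for every name $q$ of an element of $g(z)$, $\Psi(p,q)$ is a name of an element of $f(x)$. Ordered groups: an ordered group is a group $G$ with a linear order $\leq$ such that $a\leq b$ implies $ag\leq bg$ and $ga\leq gb$ for all $g$. Countable ordered groups are presented on subsets of $\mathbb{N}$, a name coding the universe, operation and order. The order type of $G$ is a linear order $X$ such that there is an order-preserving bijection $G\to X$. $\mathbb{Z}^X$ is the set of finitely supported functions $X\to\mathbb{Z}$, where for $f\neq g$, $f<g$ iff $f(x)<g(x)$ at the maximum $x$ where they differ. A copy of an ordinal $\alpha$ is a pair $(A,<_A)$ with $A\subseteq\mathbb{N}$, $<_A\subseteq A\times A$ a well-order of $A$ isomorphic to $\alpha$, coded in Baire space. $\mathsf{C}_{\mathbb{N}}$ (closed choice on $\mathbb{N}$): given an enumeration of the complement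 of a nonempty set $A\subseteq\mathbb{N}$, output an element of $A$. *)

theory Defs
  imports "HOL-Algebra.Group" "HOL-Library.Nat_Bijection"
begin

section \<open>Computable partial functions on Baire space\<close>

type_synonym baire = "nat \<Rightarrow> nat"

text \<open>Partial recursive functions relative to an oracle \<open>p\<close>: \<open>computes p e xs y\<close> says that
  program \<open>e\<close> with oracle \<open>p\<close> halts on the arguments \<open>xs\<close> with output \<open>y\<close>.  The rules for
  minimisation and composition require all the values they refer to be defined.\<close>

datatype program =
    Zero
  | Succ
  | Proj nat
  | Query
  | Comp program "program list"
  | PrimRec program program
  | Mu program

inductive computes :: "baire \<Rightarrow> program \<Rightarrow> nat list \<Rightarrow> nat \<Rightarrow> bool" for p :: baire where
  zero: "computes p Zero xs 0"
| succ: "computes p Succ [x] (Suc x)"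
| proj: "i < length xs \<Longrightarrow> computes p (Proj i) xs (xs ! i)"
| query: "computes p Query [x] (p x)"
| comp: "length ys = length gs \<Longrightarrow> (\<forall>i < length gs. computes p (gs ! i) xs (ys ! i)) \<Longrightarrow>
    computes p f ys z \<Longrightarrow> computes p (Comp f gs) xs z"
| prec_0: "computes p f xs y \<Longrightarrow> computes p (PrimRec f g) (0 # xs) y"
| prec_Suc: "computes p (PrimRec f g) (n # xs) y \<Longrightarrow> computes p g (n # y # xs) z \<Longrightarrow>
    computes p (PrimRec f g) (Suc n # xs) z"
| mu: "computes p f (n # xs) 0 \<Longrightarrow> (\<forall>m < n. \<exists>k. computes p f (m # xs) (Suc k)) \<Longrightarrow>
    computes p (Mu f) xs n"

text \<open>As usual in computable analysis, a restriction of a computable partial function to a smaller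
  domain still counts as computable.\<close>

definition computable :: "(baire \<rightharpoonup> baire) \<Rightarrow> bool" where
  "computable \<Phi> \<longleftrightarrow> (\<exists>e. \<forall>p q. \<Phi> p = Some q \<longrightarrow> (\<forall>n. computes p e [n] (q n)))"

definition interleave :: "baire \<Rightarrow> baire \<Rightarrow> baire" where
  "interleave p q = (\<lambda>n. if even n then p (n div 2) else q (n div 2))"

definition left :: "baire \<Rightarrow> baire" where "left p = (\<lambda>n. p (2 * n))"

definition right :: "baire \<Rightarrow> baire" where "right p = (\<lambda>n. p (2 * n + 1))"


section \<open>Represented spaces, problems and Weihrauch reducibility\<close>

text \<open>A represented space is given by its representation \<open>\<delta>\<close>; the underlying set is \<open>ran \<delta>\<close>.\<close>

type_synonym 'a representation = "baire \<rightharpoonup> 'a"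

text \<open>A partial multi-valued function, with \<open>solutions P x = {}\<close> for \<open>x\<close> outside the domain.\<close>

record ('a, 'b) problem =
  input_rep :: "'a representation"
  output_rep :: "'b representation"
  solutions :: "'a \<Rightarrow> 'b set"

definition problem_dom :: "('a, 'b) problem \<Rightarrow> 'a set" where
  "problem_dom P = {x \<in> ran (input_rep P). solutions P x \<noteq> {}}"

definition weihrauch_le :: "('a, 'b) problem \<Rightarrow> ('c, 'd) problem \<Rightarrow> bool"
    (infix \<open>\<le>\<^sub>W\<close> 50) where
  "f \<le>\<^sub>W g \<longleftrightarrow>
    (\<exists>\<Phi> \<Psi>. computable \<Phi> \<and> computable \<Psi> \<and>
      (\<forall>p x. input_rep f p = Some x \<and> x \<in> problem_dom f \<longrightarrow>
        (\<exists>p' z. \<Phi> p = Some p' \<and> input_rep g p' = Some z \<and> z \<in> problem_dom g \<and>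
          (\<forall>q w. output_rep g q = Some w \<and> w \<in> solutions g z \<longrightarrow>
            (\<exists>r y. \<Psi> (interleave p q) = Some r \<and> output_rep f r = Some y \<and> y \<in> solutions f x)))))"


section \<open>Closed choice on the natural numbers\<close>

definition nat_rep :: "nat representation" where
  "nat_rep p = Some (p 0)"

text \<open>A name of \<open>A\<close> enumerates the complement of \<open>A\<close>: the value \<open>n + 1\<close> enumerates \<open>n\<close>, and \<open>0\<close>
  enumerates nothing (so that the empty set has an enumeration).\<close>

definition closed_nat_rep :: "nat set representation" where
  "closed_nat_rep p = Some {n. Suc n \<notin> range p}"

definition choice_nat :: "(nat set, nat) problem" where
  "choice_nat = \<lparr>input_rep = closed_nat_rep, output_rep = nat_rep, solutions = (\<lambda>A. A)\<rparr>"


section \<open>Sets and relations coded by characteristic functions\<close>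

definition set_rep :: "nat set representation" where
  "set_rep p = (if range p \<subseteq> {0, 1} then Some {n. p n = 1} else None)"

definition rel_rep :: "nat rel representation" where
  "rel_rep p = map_option (\<lambda>S. prod_decode ` S) (set_rep p)"


section \<open>Ordered groups\<close>

record 'a ordered_monoid = "'a monoid" +
  leq :: "'a rel"

locale ordered_group = group G for G :: "'a ordered_monoid" (structure) +
  assumes linear_leq: "linear_order_on (carrier G) (leq G)"
    and leq_mult_right: "(a, b) \<in> leq G \<Longrightarrow> g \<in> carrier G \<Longrightarrow> (a \<otimes> g, b \<otimes> g) \<in> leq G"
    and leq_mult_left: "(a, b) \<in> leq G \<Longrightarrow> g \<in> carrier G \<Longrightarrow> (g \<otimes> a, g \<otimes> b) \<in> leq G"

text \<open>The structure on \<open>U\<close> whose operation is coded by \<open>m\<close>.  The operation is set to \<open>undefined\<close>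
  outside \<open>U\<close>; the unit is not coded, since a group operation determines it.\<close>

definition ordered_monoid_of :: "nat set \<Rightarrow> baire \<Rightarrow> nat rel \<Rightarrow> nat ordered_monoid" where
  "ordered_monoid_of U m R =
    \<lparr>carrier = U,
     mult = (\<lambda>x y. if x \<in> U \<and> y \<in> U then m (prod_encode (x, y)) else undefined),
     one = (THE e. e \<in> U \<and> (\<forall>x\<in>U. m (prod_encode (e, x)) = x \<and> m (prod_encode (x, e)) = x)),
     leq = R\<rparr>"

text \<open>The represented space of ordered groups with universe a subset of \<open>\<nat>\<close>.  A name consists
  of the universe, the operation and the non-strict order.\<close>

definition ordered_group_rep :: "nat ordered_monoid representation" where
  "ordered_group_rep p =
    (case (set_rep (left p), rel_rep (right (right p))) of
       (Some U, Some R) \<Rightarrow>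
         (let G = ordered_monoid_of U (left (right p)) R in
          if ordered_group G then Some G else None)
     | _ \<Rightarrow> None)"


section \<open>Order types\<close>

text \<open>Linear orders are given as reflexive relations, so that the underlying set is the field;
  ordinals are represented by well-orders in this sense.\<close>

definition has_order_type :: "'a rel \<Rightarrow> 'b rel \<Rightarrow> bool" where
  "has_order_type r s \<longleftrightarrow>
    (\<exists>h. bij_betw h (Field r) (Field s) \<and> (\<forall>a b. (a, b) \<in> r \<longrightarrow> (h a, h b) \<in> s))"

text \<open>Functions from \<open>Field r\<close> to the integers are extended by \<open>0\<close>.\<close>

definition int_power_carrier :: "'a rel \<Rightarrow> ('a \<Rightarrow> int) set" where
  "int_power_carrier r = {f. finite {x. f x \<noteq> 0} \<and> {x. f x \<noteq> 0} \<subseteq> Field r}"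

definition int_power_less :: "'a rel \<Rightarrow> ('a \<Rightarrow> int) \<Rightarrow> ('a \<Rightarrow> int) \<Rightarrow> bool" where
  "int_power_less r f g \<longleftrightarrow>
    (\<exists>x \<in> Field r. f x < g x \<and> (\<forall>y \<in> Field r. f y \<noteq> g y \<longrightarrow> (y, x) \<in> r))"

definition int_power :: "'a rel \<Rightarrow> ('a \<Rightarrow> int) rel" where
  "int_power r =
    {(f, g) \<in> int_power_carrier r \<times> int_power_carrier r. f = g \<or> int_power_less r f g}"


section \<open>From ordered groups to copies of ordinals\<close>

text \<open>\<open>(A, S)\<close> is a copy of the ordinal \<open>\<alpha>\<close>; here \<open>S\<close> is the strict order.\<close>

definition is_copy :: "'a rel \<Rightarrow> nat set \<times> nat rel \<Rightarrow> bool" where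
  "is_copy \<alpha> = (\<lambda>(A, S). S \<subseteq> A \<times> A \<and> irrefl S \<and> well_order_on A (S \<union> Id_on A) \<and>
    (S \<union> Id_on A, \<alpha>) \<in> ordIso)"

definition strict_rel_rep :: "(nat set \<times> nat rel) representation" where
  "strict_rel_rep p =
    (case (set_rep (left p), rel_rep (right p)) of
       (Some A, Some S) \<Rightarrow> if S \<subseteq> A \<times> A then Some (A, S) else None
     | _ \<Rightarrow> None)"

text \<open>Ordinals are taken as well-orders of sets of natural numbers.  This is no restriction: \<open>G\<close> is
  countable, and \<open>\<alpha>\<close> embeds into \<open>int_power \<alpha>\<close> by indicator functions of points, so only countable
  ordinals can occur.\<close>

definition OG_to_alpha0 :: "(nat ordered_monoid, nat set \<times> nat rel) problem" where
  "OG_to_alpha0 =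
    \<lparr>input_rep = ordered_group_rep,
     output_rep = strict_rel_rep,
     solutions = (\<lambda>G. {C. \<exists>\<alpha> :: nat rel. Well_order \<alpha> \<and>
       has_order_type (leq G) (int_power \<alpha>) \<and> is_copy \<alpha> C})\<rparr>"

end

theory Submission
  imports Defs "HOL-Computational_Algebra.Polynomial" "HOL-Library.Countable_Set"
begin

text \<open>The additive groups \<open>\<int>[X]\<close>, ordered by the sign of the leading coefficient, and \<open>\<int>\<close> have the
  order types \<open>\<int>\<^sup>\<omega>\<close> and \<open>\<int>\<^sup>1\<close>.  A finite part of a name of \<open>\<int>[X]\<close> never excludes
  \<open>\<int>\<close>: evaluating the finitely many polynomials that it mentions at a sufficiently large integer
  preserves sums and the order, and fixes the constants.  Conversely, every finite part of a name of
  \<open>\<int>\<close> extends to a name of \<open>\<int>[X]\<close> in which the integers mentioned are the constants.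

  Suppose that \<open>OG_to_alpha0 \<le>\<^sub>W choice_nat\<close>.  For all \<open>n\<close> and \<open>m\<close>, a name of \<open>\<int>[X]\<close> makes either
  the forward functional reject \<open>n\<close> or the backward functional, when given \<open>n\<close>, put a number above
  \<open>m\<close> into the copy, because a copy of \<open>\<omega>\<close> is infinite.  A finite part of the name suffices for this.
  Meeting these requirements one after the other, in the manner of the Baire category theorem, yields
  a name of \<open>\<int>\<close> that meets all of them, which is absurd since a copy of \<open>1\<close> is finite.\<close>

subsection \<open>Continuity and determinism of oracle computations\<close>

text \<open>A halting computation is a finite derivation, so it queries the oracle at only finitely
  many places, and some \<open>b\<close> bounds them.\<close>

lemma computes_use:
  "computes p e xs y \<Longrightarrow> \<exists>b. \<forall>q. (\<forall>n<b. q n = p n) \<longrightarrow> computes q e xs y"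
proof (induction rule: computes.induct)
  case (query x)
  show ?case
    by (metis computes.query lessI)
next
  case (comp ys gs xs f z)
  obtain b where b: "\<And>q. (\<forall>n<b. q n = p n) \<Longrightarrow> computes q f ys z"
    using comp.IH by blast
  obtain c where c: "\<And>i q. i < length gs \<Longrightarrow> (\<forall>n<c i. q n = p n) \<Longrightarrow> computes q (gs ! i) xs (ys ! i)"
    using comp.IH by metis
  \<comment> \<open>Adding the bounds gives one that dominates each of them, also when
    \<open>gs\<close> is empty.\<close>
  define d where "d = b + (\<Sum>i<length gs. c i)"
  have "c i \<le> d" if "i < length gs" for i
    using member_le_sum[of i "{..<length gs}" c] that by (simp add: d_def)
  moreover have "b \<le> d"
    by (simp add: d_def)
  ultimately have "computes q (Comp f gs) xs z" if "\<forall>n<d. q n = p n" for q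
    using that comp.hyps
    by (intro computes.comp[of ys gs] allI impI) (auto intro!: b c dest: order_less_le_trans)
  then show ?case by blast
next
  case (prec_Suc f g n xs y z)
  then obtain b c where "\<forall>q. (\<forall>n<b. q n = p n) \<longrightarrow> computes q (PrimRec f g) (n # xs) y"
    "\<forall>q. (\<forall>n<c. q n = p n) \<longrightarrow> computes q g (n # y # xs) z" by blast
  then have "\<forall>q. (\<forall>n<max b c. q n = p n) \<longrightarrow> computes q (PrimRec f g) (Suc n # xs) z"
    by (auto intro: computes.prec_Suc[where y = y])
  then show ?case by blast
next
  case (mu f n xs)
  obtain b where b: "\<And>q. (\<forall>n<b. q n = p n) \<Longrightarrow> computes q f (n # xs) 0"
    using mu.IH by blast
  obtain c k where c: "\<And>m q. m < n \<Longrightarrow> (\<forall>n<c m. q n = p n) \<Longrightarrow> computes q f (m # xs) (Suc (k m))"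
    using mu.IH by metis
  define d where "d = b + (\<Sum>m<n. c m)"
  have "c m \<le> d" if "m < n" for m
    using member_le_sum[of m "{..<n}" c] that by (simp add: d_def)
  moreover have "b \<le> d"
    by (simp add: d_def)
  ultimately have "computes q (Mu f) xs n" if "\<forall>n<d. q n = p n" for q
    using that b c by (intro computes.mu) (auto, meson order_less_le_trans)
  then show ?case by blast
qed (blast intro: computes.intros)+

text \<open>Lets a value found by a program be identified with the value of the functional that the
  program realizes.\<close>

lemma computes_deterministic:
  "computes p e xs y \<Longrightarrow> computes p e xs z \<Longrightarrow> y = z"
proof (induction arbitrary: z rule: computes.induct)
  case (comp ys gs xs f w)
  from comp.prems obtain ys' where ys': "length ys' = length gs"
    "\<forall>i<length gs. computes p (gs ! i) xs (ys' ! i)" "computes p f ys' z"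
    by (cases rule: computes.cases) auto
  have "ys = ys'"
    using comp ys' by (intro nth_equalityI) auto
  with comp ys' show ?case by blast
next
  case (prec_Suc f g n xs y w)
  from prec_Suc.prems show ?case
    by (cases rule: computes.cases) (use prec_Suc.IH in blast)
next
  case (prec_0 f xs y g)
  from prec_0.prems show ?case
    by (cases rule: computes.cases) (use prec_0.IH in blast)
next
  case (mu f n xs)
  from mu.prems obtain "computes p f (z # xs) 0" "\<forall>m<z. \<exists>k. computes p f (m # xs) (Suc k)"
    by (cases rule: computes.cases) auto
  with mu show ?case
    by (metis linorder_neqE_nat nat.distinct(1))
qed (auto elim: computes.cases)

lemma left_interleave [simp]: "left (interleave p q) = p"
  by (simp add: left_def interleave_def)

lemma right_interleave [simp]: "right (interleave p q) = q"
  by (auto simp: right_def interleave_def)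

text \<open>Position \<open>n\<close> reads position \<open>n div 2\<close>, which is at most
  \<open>n\<close>, so one bound serves both halves and their interleaving.\<close>

lemma interleave_cong:
  assumes "\<And>n. n < b \<Longrightarrow> p n = p' n" "\<And>n. n < b \<Longrightarrow> q n = q' n" "n < b"
  shows "interleave p q n = interleave p' q' n"
  using assms by (simp add: interleave_def)

subsection \<open>Names of groups with universe all of the natural numbers\<close>

text \<open>The additive group and its order are transported to the indices along the enumeration
  \<nu>; the constant sequence 1 codes the universe of all natural numbers.\<close>

definition group_name :: "(nat \<Rightarrow> 'a::linordered_ab_group_add) \<Rightarrow> baire" where
  "group_name \<nu> = interleave (\<lambda>_. 1)
    (interleave (\<lambda>n. case prod_decode n of (i, j) \<Rightarrow> inv_into UNIV \<nu> (\<nu> i + \<nu> j))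
      (\<lambda>n. case prod_decode n of (i, j) \<Rightarrow> if \<nu> i \<le> \<nu> j then 1 else 0))"

lemma ordered_group_rep_group_name:
  fixes \<nu> :: "nat \<Rightarrow> 'a::linordered_ab_group_add"
  assumes "bij \<nu>"
  obtains G where "ordered_group_rep (group_name \<nu>) = Some G" "leq G = {(i, j). \<nu> i \<le> \<nu> j}"
proof
  have inv [simp]: "\<nu> (inv_into UNIV \<nu> x) = x" "inv_into UNIV \<nu> (\<nu> i) = i" for x i
    using assms by (auto simp: bij_def surj_f_inv_f)
  have inj: "\<nu> i = \<nu> j \<longleftrightarrow> i = j" for i j
    using assms by (auto simp: bij_def inj_eq)
  define m where "m = (\<lambda>n. case prod_decode n of (i, j) \<Rightarrow> inv_into UNIV \<nu> (\<nu> i + \<nu> j))"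
  define R where "R = {(i, j). \<nu> i \<le> \<nu> j}"
  define G where "G = ordered_monoid_of UNIV m R"
  \<comment> \<open>Testing a candidate unit against the index of 0 forces it to be that
    index.\<close>
  have "(THE e. \<forall>x. m (prod_encode (e, x)) = x \<and> m (prod_encode (x, e)) = x) = inv_into UNIV \<nu> 0"
    by (rule the_equality) (auto simp: m_def inj[symmetric] dest!: spec[of _ "inv_into UNIV \<nu> 0"])
  then have G: "carrier G = UNIV" "monoid.mult G = (\<lambda>i j. inv_into UNIV \<nu> (\<nu> i + \<nu> j))"
    "one G = inv_into UNIV \<nu> 0" "leq G = R"
    by (simp_all add: G_def ordered_monoid_of_def m_def)
  have "group G"
  proof (rule groupI)
    fix x
    show "\<exists>y\<in>carrier G. y \<otimes>\<^bsub>G\<^esub> x = \<one>\<^bsub>G\<^esub>"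
      by (rule bexI[of _ "inv_into UNIV \<nu> (- \<nu> x)"]) (auto simp: G)
  qed (auto simp: G add.assoc)
  then have "ordered_group G"
    by (auto simp: ordered_group_def ordered_group_axioms_def G R_def inj linear_order_on_def
        partial_order_on_def preorder_on_def refl_on_def trans_def antisym_def total_on_def)
  moreover have "set_rep (\<lambda>_. 1) = Some UNIV"
    by (auto simp: set_rep_def)
  moreover have "rel_rep (\<lambda>n. case prod_decode n of (i, j) \<Rightarrow> if \<nu> i \<le> \<nu> j then 1 else 0) = Some R"
  proof -
    have "{n. \<nu> (fst (prod_decode n)) \<le> \<nu> (snd (prod_decode n))} = prod_decode -` R"
      by (auto simp: R_def split_beta)
    then have "prod_decode ` {n. \<nu> (fst (prod_decode n)) \<le> \<nu> (snd (prod_decode n))} = R"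
      by (simp add: surj_prod_decode)
    then show ?thesis
      by (auto simp: rel_rep_def set_rep_def split_beta)
  qed
  ultimately show "ordered_group_rep (group_name \<nu>) = Some G"
    by (simp add: ordered_group_rep_def group_name_def Let_def G_def m_def)
  show "leq G = {(i, j). \<nu> i \<le> \<nu> j}"
    by (simp add: G R_def)
qed

subsection \<open>The order type determines whether the exponent is finite\<close>

text \<open>Keeps the witness of \<open>int_power_less\<close>, the topmost point of difference, so
  that it can be compared along chains of functions.\<close>

definition differ_at :: "'a rel \<Rightarrow> ('a \<Rightarrow> int) \<Rightarrow> ('a \<Rightarrow> int) \<Rightarrow> 'a \<Rightarrow> bool" where
  "differ_at r f g x \<longleftrightarrow> x \<in> Field r \<and> f x < g x \<and> (\<forall>y \<in> Field r. f y \<noteq> g y \<longrightarrow> (y, x) \<in> r)"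

lemma int_power_less_iff: "int_power_less r f g \<longleftrightarrow> (\<exists>x. differ_at r f g x)"
  by (auto simp: int_power_less_def differ_at_def)

lemma differ_at_unique:
  assumes "antisym r" "differ_at r f g x" "differ_at r f g y"
  shows "x = y"
  using assms by (force simp: differ_at_def antisym_def)

lemma differ_at_asym:
  assumes "antisym r" "differ_at r f g x" "differ_at r g f y"
  shows False
proof -
  have "(y, x) \<in> r" "(x, y) \<in> r"
    using assms(2,3) by (force simp: differ_at_def)+
  then have "x = y"
    using assms(1) by (simp add: antisym_def)
  then show False
    using assms(2,3) by (simp add: differ_at_def)
qed

text \<open>The greater of the two points works: only one of the two steps changes the value there
  or, if the points coincide, the two increases add up.\<close>

lemma differ_at_trans:
  assumes r: "Linear_order r" and x: "differ_at r f g x" and y: "differ_at r g h y"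
  obtains z where "differ_at r f h z" "(x, z) \<in> r" "(y, z) \<in> r"
proof -
  have F: "x \<in> Field r" "y \<in> Field r"
    using x y by (auto simp: differ_at_def)
  have tr: "trans r" and an: "antisym r" and rf: "\<And>x. x \<in> Field r \<Longrightarrow> (x, x) \<in> r"
    using r by (auto simp: order_on_defs refl_on_def)
  consider "(x, y) \<in> r" "x \<noteq> y" | "(y, x) \<in> r" "x \<noteq> y" | "x = y"
    using r F by (auto simp: order_on_defs total_on_def)
  then show thesis
  proof cases
    case 1
    have "f y = g y"
      using x 1 an F by (auto simp: differ_at_def antisym_def)
    then have "differ_at r f h y"
      using x y 1 tr by (auto simp: differ_at_def trans_def)
    then show ?thesis
      using that 1 F rf by blast
  next
    case 2
    have "g x = h x"
      using y 2 an F by (auto simp: differ_at_def antisym_def)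
    then have "differ_at r f h x"
      using x y 2 tr by (auto simp: differ_at_def trans_def)
    then show ?thesis
      using that 2 F rf by blast
  next
    case 3
    then have "differ_at r f h x"
      using x y by (auto simp: differ_at_def)
    then show ?thesis
      using that 3 F rf by blast
  qed
qed

lemma int_powerD:
  assumes "(f, g) \<in> int_power r" "f \<noteq> g"
  obtains x where "differ_at r f g x"
  using assms by (auto simp: int_power_def int_power_less_iff)

lemma Field_int_power: "Field (int_power r) = int_power_carrier r"
  by (auto simp: Field_def int_power_def)

lemma antisym_int_power:
  assumes "antisym r"
  shows "antisym (int_power r)"
  by (rule antisymI) (metis assms differ_at_asym int_powerD)

text \<open>An order-theoretic lower bound for the exponent: in an integer power, the endpoints of a ladder of
  height \<open>k\<close> first differ, from the top, at a point with at least \<open>k\<close> predecessors.\<close>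

fun ladder :: "'a rel \<Rightarrow> nat \<Rightarrow> 'a \<Rightarrow> 'a \<Rightarrow> bool" where
  "ladder r 0 x y \<longleftrightarrow> (x, y) \<in> r \<and> x \<noteq> y"
| "ladder r (Suc k) x y \<longleftrightarrow>
    (\<exists>z :: nat \<Rightarrow> 'a. z 0 = x \<and> (\<forall>i. ladder r k (z i) (z (Suc i)) \<and> (z i, y) \<in> r))"

text \<open>At height 0 injectivity keeps the endpoints distinct; higher up, \<open>h\<close> is
  applied to all rungs.\<close>

lemma ladder_map:
  assumes "\<And>a b. (a, b) \<in> r \<Longrightarrow> (h a, h b) \<in> s" "inj_on h (Field r)"
  shows "ladder r k x y \<Longrightarrow> ladder s k (h x) (h y)"
proof (induction k arbitrary: x y)
  case 0
  then show ?case
    using assms by (auto dest: inj_onD intro: FieldI1 FieldI2)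
next
  case (Suc k)
  then obtain z where "z 0 = x" "\<And>i. ladder r k (z i) (z (Suc i))" "\<And>i. (z i, y) \<in> r"
    by auto
  then show ?case
    using Suc.IH assms(1) by (auto intro!: exI[of _ "h \<circ> z"])
qed

text \<open>Suppose the endpoints of a ladder of height \<open>Suc k\<close> differ at a point with
  at most \<open>k\<close> predecessors. This point dominates the points where successive rungs
  differ, each of which has at least \<open>k\<close> predecessors, so all of them equal it. The
  rungs then increase there forever below a fixed integer, which is impossible.\<close>

lemma ladder_int_power:
  assumes r: "Linear_order r" and fin: "finite (Field r)"
  shows "ladder (int_power r) k f g \<Longrightarrow> \<exists>x. differ_at r f g x \<and> k \<le> card (underS r x)"
proof (induction k arbitrary: f g)
  case 0
  then show ?case
    by (auto elim: int_powerD)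
next
  case (Suc k)
  have an: "antisym r" and tr: "trans r"
    using r by (auto simp: order_on_defs)
  have fin_under: "finite (underS r y)" for y
    by (rule finite_subset[OF _ fin]) (auto simp: underS_def Field_def)
  from Suc.prems obtain z where z: "z 0 = f" "\<And>i. ladder (int_power r) k (z i) (z (Suc i))"
    "\<And>i. (z i, g) \<in> int_power r"
    by auto
  obtain x where x: "\<And>i. differ_at r (z i) (z (Suc i)) (x i)" "\<And>i. k \<le> card (underS r (x i))"
    using Suc.IH[OF z(2)] by metis
  \<comment> \<open>Otherwise rung \<open>Suc i\<close> would lie strictly above \<open>g\<close>,
    although no rung does.\<close>
  have "z i \<noteq> g" for i
  proof
    assume i: "z i = g"
    show False
      using x(1)[of i] z(3)[of "Suc i"] differ_at_asym[OF an] i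
      by (metis int_powerD differ_at_def less_irrefl)
  qed
  then have "\<exists>y. differ_at r (z i) g y" for i
    using z(3) by (metis int_powerD)
  then obtain y where y: "\<And>i. differ_at r (z i) g (y i)"
    by metis
  \<comment> \<open>From \<open>z i < z (Suc i) < g\<close>, the point \<open>y i\<close> lies
    weakly above both \<open>x i\<close> and \<open>y (Suc i)\<close>.\<close>
  have step: "(x i, y i) \<in> r \<and> (y (Suc i), y i) \<in> r" for i
    using differ_at_trans[OF r x(1)[of i] y[of "Suc i"]] differ_at_unique[OF an] y[of i] by metis
  have y0: "(y i, y 0) \<in> r" for i
  proof (induction i)
    case 0
    show ?case
      using y[of 0] r by (auto simp: order_on_defs refl_on_def differ_at_def)
  next
    case (Suc i)
    then show ?case
      using step[of i] tr by (meson transD)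
  qed
  have "Suc k \<le> card (underS r (y 0))"
  proof (rule ccontr)
    assume neg: "\<not> Suc k \<le> card (underS r (y 0))"
    have xy: "x i = y 0" for i
    proof (rule ccontr)
      assume ne: "x i \<noteq> y 0"
      have "(x i, y 0) \<in> r"
        using step[of i] y0[of i] tr by (meson transD)
      then have "underS r (x i) \<subset> underS r (y 0)"
        using ne an tr unfolding underS_def antisym_def trans_def by blast
      then have "card (underS r (x i)) < card (underS r (y 0))"
        by (rule psubset_card_mono[OF fin_under])
      then show False
        using x(2)[of i] neg by simp
    qed
    have "y i = y 0" for i
      using step[of i] y0[of i] an by (auto simp: xy antisym_def)
    then have bound: "z i (y 0) < g (y 0)" for i
      using y[of i] by (metis differ_at_def)
    have "z 0 (y 0) + int i \<le> z i (y 0)" for i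
    proof (induction i)
      case (Suc i)
      then show ?case
        using x(1)[of i] by (simp add: differ_at_def xy)
    qed simp
    \<comment> \<open>At this index the lower bound has already reached \<open>g (y 0)\<close>;
      \<open>bound[of 0]\<close> makes the difference positive, so that \<open>nat\<close> loses
      nothing.\<close>
    from this[of "nat (g (y 0) - z 0 (y 0))"] bound[of "nat (g (y 0) - z 0 (y 0))"] bound[of 0]
    show False
      by simp
  qed
  then show ?case
    using y[of 0] z(1) by blast
qed

text \<open>The rungs are \<open>p + t X^k\<close> for all natural \<open>t\<close>: consecutive
  ones differ by \<open>X^k\<close>, and all stay below \<open>p + X^(k+1)\<close> because the
  leading coefficient decides the order.\<close>

lemma poly_monom_ladder:
  fixes \<nu> :: "nat \<Rightarrow> int poly"
  assumes "bij \<nu>" "p + monom 1 k \<le> q"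
  shows "ladder {(i, j). \<nu> i \<le> \<nu> j} k (inv_into UNIV \<nu> p) (inv_into UNIV \<nu> q)"
proof -
  have inv: "\<nu> (inv_into UNIV \<nu> x) = x" for x
    using assms(1) by (simp add: bij_def surj_f_inv_f)
  then have inv_eq: "inv_into UNIV \<nu> x = inv_into UNIV \<nu> y \<longleftrightarrow> x = y" for x y
    by metis
  show ?thesis
    using assms(2)
  proof (induction k arbitrary: p q)
    case 0
    have "p < p + monom 1 0"
      by simp
    then have "p < q"
      using 0 by (rule order_less_le_trans)
    then show ?case
      by (auto simp: inv inv_eq)
  next
    case (Suc k)
    have le: "p + monom (int t) k \<le> q" for t
    proof -
      have "degree (monom (int t) k) < degree (monom (1 :: int) (Suc k))"
        by (simp add: degree_monom_eq degree_monom_le le_imp_less_Suc)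
      then have "pos_poly (monom 1 (Suc k) - monom (int t) k)"
        using degree_add_eq_left[of "- monom (int t) k" "monom 1 (Suc k)"]
        by (simp add: pos_poly_def degree_monom_eq)
      then have "monom (int t) k \<le> monom 1 (Suc k)"
        by (simp add: less_eq_poly_def)
      then show ?thesis
        using Suc.prems by (meson add_left_mono order_trans)
    qed
    have "ladder {(i, j). \<nu> i \<le> \<nu> j} k (inv_into UNIV \<nu> (p + monom (int t) k))
        (inv_into UNIV \<nu> (p + monom (int (Suc t)) k))" for t
      by (rule Suc.IH) (simp add: add.assoc add_monom add.commute)
    then show ?case
      using le by (auto simp: inv intro!: exI[of _ "\<lambda>t. inv_into UNIV \<nu> (p + monom (int t) k)"])
  qed
qed

text \<open>0 and \<open>X^k\<close> are the ends of a ladder of height \<open>k\<close>. With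
  \<open>k\<close> greater than the size of a finite exponent, the transferred ladder would need a
  point with more predecessors than there are points.\<close>

lemma order_type_poly_infinite:
  fixes \<nu> :: "nat \<Rightarrow> int poly"
  assumes "bij \<nu>" "Well_order r" "has_order_type {(i, j). \<nu> i \<le> \<nu> j} (int_power r)"
  shows "infinite (Field r)"
proof
  assume fin: "finite (Field r)"
  obtain h where h: "bij_betw h (Field {(i, j). \<nu> i \<le> \<nu> j}) (Field (int_power r))"
    "\<And>a b. (a, b) \<in> {(i, j). \<nu> i \<le> \<nu> j} \<Longrightarrow> (h a, h b) \<in> int_power r"
    using assms(3) unfolding has_order_type_def by blast
  let ?k = "Suc (card (Field r))"
  have "ladder {(i, j). \<nu> i \<le> \<nu> j} ?k (inv_into UNIV \<nu> 0) (inv_into UNIV \<nu> (monom 1 ?k))"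
    by (rule poly_monom_ladder[OF assms(1)]) simp
  then have "ladder (int_power r) ?k (h (inv_into UNIV \<nu> 0)) (h (inv_into UNIV \<nu> (monom 1 ?k)))"
    by (rule ladder_map[rotated 2]) (use h in \<open>auto simp only: bij_betw_def\<close>)
  moreover have "Linear_order r"
    using assms(2) by (simp only: well_order_on_def)
  ultimately obtain x where "?k \<le> card (underS r x)"
    using ladder_int_power[OF _ fin] by blast
  moreover have "card (underS r x) \<le> card (Field r)"
    by (rule card_mono[OF fin]) (auto simp: underS_def Field_def)
  ultimately show False
    by simp
qed

text \<open>Intervals of integers are finite, whereas two points \<open>x\<close> below
  \<open>y\<close> of the exponent put every nonnegative multiple of the indicator of
  \<open>x\<close> between 0 and the indicator of \<open>y\<close>.\<close>

lemma order_type_int_finite: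
  fixes \<nu> :: "nat \<Rightarrow> int"
  assumes "bij \<nu>" "Well_order r" "has_order_type {(i, j). \<nu> i \<le> \<nu> j} (int_power r)"
  shows "finite (Field r)"
proof (rule ccontr)
  assume inf: "infinite (Field r)"
  let ?R = "{(i, j). \<nu> i \<le> \<nu> j}"
  have r: "Linear_order r" "antisym r"
    using assms(2) by (auto simp: order_on_defs)
  have "Field ?R = UNIV"
    by (auto simp: Field_def)
  then obtain h where h: "bij_betw h UNIV (int_power_carrier r)"
    "\<And>a b. \<nu> a \<le> \<nu> b \<Longrightarrow> (h a, h b) \<in> int_power r"
    using assms(3) unfolding has_order_type_def Field_int_power by auto
  obtain a b where ab: "a \<in> Field r" "b \<in> Field r" "a \<noteq> b"
    by (metis inf finite.emptyI finite.insertI finite_subset insertI1 subsetI singletonI)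
  then obtain x y where xy: "(x, y) \<in> r" "x \<noteq> y" "x \<in> Field r" "y \<in> Field r"
    using r(1) unfolding order_on_defs total_on_def by metis
  define c where "c = (\<lambda>(k::nat) u. if u = x then int k else 0)"
  define d where "d = (\<lambda>u. if u = y then 1 else (0::int))"
  have carrier: "c k \<in> int_power_carrier r" "d \<in> int_power_carrier r" for k
    using xy by (auto simp: int_power_carrier_def c_def d_def)
  have "differ_at r (c k) d y" "k \<noteq> 0 \<Longrightarrow> differ_at r (c 0) (c k) x" for k
    using xy r(1) by (auto simp: differ_at_def c_def d_def order_on_defs refl_on_def split: if_splits)
  then have cd: "(c k, d) \<in> int_power r" "(c 0, c k) \<in> int_power r" for k
    using carrier by (cases "k = 0"; auto simp: int_power_def int_power_less_iff)+
  define g where "g = inv_into UNIV h"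
  have g: "h (g f) = f" if "f \<in> int_power_carrier r" for f
    using that h(1) unfolding g_def bij_betw_def by (metis f_inv_into_f)
  \<comment> \<open>\<open>h\<close> is only known to preserve the order forwards; totality of the
    integers and antisymmetry give the same for its inverse.\<close>
  have mono: "\<nu> (g e) \<le> \<nu> (g f)" if "(e, f) \<in> int_power r" for e f
  proof (rule ccontr)
    assume neg: "\<not> \<nu> (g e) \<le> \<nu> (g f)"
    have ef: "e \<in> int_power_carrier r" "f \<in> int_power_carrier r"
      using that by (auto simp: int_power_def)
    then have "(f, e) \<in> int_power r"
      using h(2)[of "g f" "g e"] neg by (simp add: g)
    then have "e = f"
      using that antisym_int_power[OF r(2)] by (simp add: antisym_def)
    then show False
      using neg by simp
  qed
  have "range (\<lambda>k. \<nu> (g (c k))) \<subseteq> {\<nu> (g (c 0))..\<nu> (g d)}"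
    using cd mono by auto
  moreover have "inj (\<lambda>k. \<nu> (g (c k)))"
  proof (rule injI)
    fix k l assume "\<nu> (g (c k)) = \<nu> (g (c l))"
    then have "c k = c l"
      using assms(1) g carrier by (metis bij_def injD)
    then show "k = l"
      by (auto simp: c_def fun_eq_iff split: if_splits)
  qed
  ultimately show False
    by (meson finite_atLeastAtMost_int finite_imageD finite_subset infinite_UNIV_nat)
qed

lemma is_copy_finite_iff:
  assumes "is_copy r (A, S)"
  shows "finite A \<longleftrightarrow> finite (Field r)"
proof -
  have "Field (S \<union> Id_on A) = A"
    using assms by (auto simp: is_copy_def Field_def)
  then obtain f where "bij_betw f A (Field r)"
    using assms by (auto simp: is_copy_def ordIso_def BNF_Wellorder_Embedding.iso_def simp del: Field_Un)
  then show ?thesis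
    by (rule bij_betw_finite)
qed

subsection \<open>Collapsing integer polynomials to integers\<close>

lemma countable_int_poly: "countable (UNIV :: int poly set)"
proof (rule countableI')
  show "inj (\<lambda>p :: int poly. to_nat (coeffs p))"
    by (auto intro!: injI simp: coeffs_eq_iff)
qed

lemma infinite_int_poly: "infinite (UNIV :: int poly set)"
proof
  assume "finite (UNIV :: int poly set)"
  moreover have "inj (\<lambda>c :: int. [:c:])"
    by (auto intro: injI)
  ultimately show False
    by (meson finite_imageD finite_subset infinite_UNIV_int subset_UNIV)
qed

text \<open>The list is followed by an enumeration of the remaining elements, which are again
  countably infinite in number.\<close>

lemma bij_extending_list:
  assumes "countable (UNIV :: 'a set)" "infinite (UNIV :: 'a set)" "distinct (u :: 'a list)"
  obtains f :: "nat \<Rightarrow> 'a" where "bij f" "\<And>i. i < length u \<Longrightarrow> f i = u ! i"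
proof -
  define g where "g = from_nat_into (- set u)"
  have g: "bij_betw g UNIV (- set u)"
    unfolding g_def using assms
    by (intro bij_betw_from_nat_into) (auto simp: Compl_eq_Diff_UNIV intro: countable_subset)
  define f where "f i = (if i < length u then u ! i else g (i - length u))" for i
  have "bij_betw f {..<length u} (set u)"
    using bij_betw_nth[OF assms(3) refl refl]
    by (rule bij_betw_cong[THEN iffD1, rotated]) (simp add: f_def)
  moreover have "bij_betw f {length u..} (- set u)"
  proof -
    have "bij_betw (\<lambda>i. i - length u) {length u..} UNIV"
      by (rule bij_betwI[where g = "\<lambda>i. i + length u"]) auto
    from bij_betw_trans[OF this g] show ?thesis
      by (rule bij_betw_cong[THEN iffD1, rotated]) (simp add: f_def)
  qed
  ultimately have "bij_betw f ({..<length u} \<union> {length u..}) (set u \<union> - set u)"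
    by (rule bij_betw_combine) auto
  moreover have "{..<length u} \<union> {length u..} = UNIV"
    by auto
  ultimately have "bij f"
    by simp
  then show ?thesis
    by (rule that) (simp add: f_def)
qed

text \<open>For a polynomial \<open>a + X p\<close> with \<open>p\<close> nonzero, the value
  \<open>poly p N\<close> is eventually at least 1, and then \<open>N > |a|\<close> outweighs the
  constant term.\<close>

lemma int_poly_eventually_pos:
  fixes p :: "int poly"
  assumes "p > 0"
  shows "\<forall>\<^sub>F N in at_top. 0 < poly p N"
proof -
  have "pos_poly p \<Longrightarrow> \<forall>\<^sub>F N in at_top. 0 < poly p N"
  proof (induction p)
    case (pCons a p)
    show ?case
    proof (cases "p = 0")
      case True
      then show ?thesis
        using pCons.prems by (simp add: pos_poly_pCons)
    next
      case False
      then have "\<forall>\<^sub>F N in at_top. 0 < poly p N"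
        using pCons by (auto simp: pos_poly_pCons)
      then show ?thesis
        using eventually_gt_at_top[of "\<bar>a\<bar>"]
      proof eventually_elim
        case (elim N)
        have "N * 1 \<le> N * poly p N"
          using elim by (intro mult_left_mono) auto
        then show ?case
          using elim by simp
      qed
    qed
  qed simp
  then show ?thesis
    using assms by (simp add: less_poly_def)
qed

lemma collapse_polys:
  assumes "finite (F :: int poly set)"
  obtains N :: int where "\<And>p q. p \<in> F \<Longrightarrow> q \<in> F \<Longrightarrow> p < q \<Longrightarrow> poly p N < poly q N"
proof -
  have "\<forall>\<^sub>F N in at_top. \<forall>p\<in>F. \<forall>q\<in>F. p < q \<longrightarrow> poly p N < poly q N"
  proof (intro eventually_ball_finite ballI assms)
    fix p q :: "int poly"
    show "\<forall>\<^sub>F N in at_top. p < q \<longrightarrow> poly p N < poly q N"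
    proof (cases "p < q")
      case True
      then have "\<forall>\<^sub>F N in at_top. 0 < poly (q - p) N"
        by (intro int_poly_eventually_pos) simp
      then show ?thesis
        by eventually_elim simp
    qed simp
  qed
  then show ?thesis
    using that by (metis (mono_tags, lifting) eventually_at_top_linorder order_refl)
qed

text \<open>Evaluation at \<open>N\<close> is additive and fixes constants, and for large
  \<open>N\<close> it is strictly increasing on the finitely many polynomials in question. The list
  \<open>w\<close> holds the values at the further indices on which the first \<open>b\<close>
  entries of the name depend.\<close>

lemma collapse_name:
  fixes \<nu> :: "nat \<Rightarrow> int poly"
  assumes "bij \<nu>" and u: "\<And>i. i < length u \<Longrightarrow> \<nu> i = [:u ! i:]"
  obtains w where "w \<noteq> []" "distinct (u @ w)"
    "\<And>\<mu> :: nat \<Rightarrow> int. bij \<mu> \<Longrightarrow> \<forall>i<length (u @ w). \<mu> i = (u @ w) ! i \<Longrightarrow>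
      \<forall>n<b. group_name \<mu> n = group_name \<nu> n"
proof -
  define s where "s n = (case prod_decode n of (i, j) \<Rightarrow> inv_into UNIV \<nu> (\<nu> i + \<nu> j))" for n
  \<comment> \<open>Below \<open>l\<close> lie the indices given by \<open>u\<close>, those decoded
    from positions below \<open>b\<close>, and the indices \<open>s n\<close> of their sums;
    \<open>Suc\<close> makes \<open>w\<close> nonempty.\<close>
  define l where "l = Suc (length u + b + (\<Sum>n<b. s n))"
  have s_less: "s n < l" if "n < b" for n
    using member_le_sum[of n "{..<b}" s] that by (simp add: l_def)
  obtain N where N: "\<And>p q. p \<in> \<nu> ` {..<l} \<Longrightarrow> q \<in> \<nu> ` {..<l} \<Longrightarrow> p < q \<Longrightarrow> poly p N < poly q N"
    using collapse_polys[of "\<nu> ` {..<l}"] by auto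
  define v where "v i = poly (\<nu> i) N" for i
  have less: "v i < v j" if "i < l" "j < l" "\<nu> i < \<nu> j" for i j
    unfolding v_def using that by (intro N) auto
  have le: "v i \<le> v j \<longleftrightarrow> \<nu> i \<le> \<nu> j" if "i < l" "j < l" for i j
    using less[OF that] less[OF that(2,1)]
    by (cases "\<nu> i" "\<nu> j" rule: linorder_cases) (auto simp: v_def)
  define w where "w = map v [length u..<l]"
  have "map v [0..<length u] = u"
    by (rule nth_equalityI) (auto simp: v_def u)
  moreover have "[0..<l] = [0..<length u] @ [length u..<l]"
    using upt_add_eq_append[of 0 "length u" "l - length u"]
    by (simp add: l_def add.assoc del: upt_Suc)
  ultimately have uw: "u @ w = map v [0..<l]"
    by (simp add: w_def)
  have inj: "\<nu> i = \<nu> j \<longleftrightarrow> i = j" for i j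
    using assms(1) by (auto simp: bij_def inj_eq)
  have "inj_on v {..<l}"
    by (rule inj_onI) (metis inj le lessThan_iff order_antisym order_refl)
  then have "distinct (u @ w)"
    by (simp add: uw distinct_map atLeast0LessThan)
  moreover have "w \<noteq> []"
    by (simp add: w_def l_def)
  moreover have "\<forall>n<b. group_name \<mu> n = group_name \<nu> n"
    if "bij \<mu>" "\<forall>i<length (u @ w). \<mu> i = (u @ w) ! i" for \<mu> :: "nat \<Rightarrow> int"
  proof -
    have \<mu>: "\<mu> i = v i" if "i < l" for i
      using \<open>\<forall>i<length (u @ w). \<mu> i = (u @ w) ! i\<close> that by (simp add: uw)
    have decode: "i < l" "j < l" if "n < b" "prod_decode n = (i, j)" for n i j
      using that le_prod_encode_1[of i j] le_prod_encode_2[of j i] prod_decode_inverse[of n]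
      by (auto simp: l_def)
    \<comment> \<open>The index \<open>s n\<close> of the sum is below \<open>l\<close>, so
      evaluation gives \<open>\<mu> (s n)\<close> the value \<open>\<mu> i + \<mu> j\<close>, and
      injectivity of \<mu> returns the index.\<close>
    have "inv_into UNIV \<mu> (\<mu> i + \<mu> j) = inv_into UNIV \<nu> (\<nu> i + \<nu> j)"
      if n: "n < b" "prod_decode n = (i, j)" for n i j
    proof -
      have sn: "s n = inv_into UNIV \<nu> (\<nu> i + \<nu> j)"
        using n by (simp add: s_def)
      then have "\<nu> (s n) = \<nu> i + \<nu> j"
        using assms(1) by (simp add: bij_def surj_f_inv_f)
      then have "\<mu> (s n) = \<mu> i + \<mu> j"
        using decode[OF n] s_less[OF n(1)] by (simp add: \<mu> v_def)
      then show ?thesis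
        using \<open>bij \<mu>\<close> sn by (metis bij_def inv_f_f)
    qed
    moreover have "\<mu> i \<le> \<mu> j \<longleftrightarrow> \<nu> i \<le> \<nu> j" if "n < b" "prod_decode n = (i, j)" for n i j
      using decode[OF that] by (simp add: \<mu> le)
    ultimately show ?thesis
      unfolding group_name_def
      by (intro allI impI interleave_cong[where b = b]) (auto split: prod.split)
  qed
  ultimately show ?thesis
    using that by blast
qed

section \<open>Enumerations of the integers built from finite approximations\<close>

lemma bij_limit_of_lists:
  fixes u :: "nat \<Rightarrow> 'a list"
  assumes dist: "\<And>k. distinct (u k)" and ext: "\<And>k. \<exists>w. w \<noteq> [] \<and> u (Suc k) = u k @ w"
    and ex: "\<And>x. \<exists>k. x \<in> set (u k)"
  obtains f where "bij f" "\<And>k i. i < length (u k) \<Longrightarrow> f i = u k ! i"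
proof -
  have len: "k \<le> length (u k)" for k
  proof (induction k)
    case (Suc k)
    obtain w where "w \<noteq> []" "u (Suc k) = u k @ w"
      using ext by blast
    then show ?case
      using Suc by (cases w) auto
  qed simp
  have mono: "\<exists>w. u l = u k @ w" if "k \<le> l" for k l
    using that by (induction l rule: dec_induct) (use ext in \<open>auto, metis append.assoc\<close>)
  \<comment> \<open>Stage \<open>Suc i\<close> has more than \<open>i\<close> entries, so entry
    \<open>i\<close> is settled by then.\<close>
  define f where "f i = u (Suc i) ! i" for i
  have f: "f i = u k ! i" if "i < length (u k)" for k i
  proof -
    have "i < length (u (Suc i))"
      using len[of "Suc i"] by simp
    then show ?thesis
      using that mono[of k "Suc i"] mono[of "Suc i" k] nle_le[of k "Suc i"]
      by (auto simp: f_def nth_append)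
  qed
  have "inj f"
  proof (rule injI)
    fix i j assume eq: "f i = f j"
    define k where "k = Suc (max i j)"
    have "i < length (u k)" "j < length (u k)"
      using len[of k] by (auto simp: k_def)
    then show "i = j"
      using eq dist[of k] by (simp add: f nth_eq_iff_index_eq)
  qed
  moreover have "surj f"
    by (metis ex f in_set_conv_nth surj_def)
  ultimately show ?thesis
    using that f by (auto simp: bij_def)
qed

text \<open>A Baire category argument in which finite lists of integers are the conditions. To meet
  \<open>P k\<close>, the list is read as constants and extended to an enumeration of the integer
  polynomials; by openness a finite part of its name suffices, and collapsing makes that part the
  beginning of names of the integers.\<close>

lemma generic_int_name:
  fixes P :: "nat \<Rightarrow> baire \<Rightarrow> bool"
  assumes "open": "\<And>k p. P k p \<Longrightarrow> \<exists>b. \<forall>q. (\<forall>n<b. q n = p n) \<longrightarrow> P k q"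
    and poly: "\<And>k \<nu>. bij (\<nu> :: nat \<Rightarrow> int poly) \<Longrightarrow> P k (group_name \<nu>)"
  obtains \<mu> :: "nat \<Rightarrow> int" where "bij \<mu>" "\<forall>k. P k (group_name \<mu>)"
proof -
  \<comment> \<open>Quantifying over all enumerations that extend the new list makes the requirement
    survive every later stage.\<close>
  let ?Q = "\<lambda>k (u :: int list) u'. (\<exists>w. w \<noteq> [] \<and> u' = u @ w) \<and> int_decode k \<in> set u' \<and>
    (\<forall>\<mu>. bij \<mu> \<longrightarrow> (\<forall>i<length u'. \<mu> i = u' ! i) \<longrightarrow> P k (group_name \<mu>))"
  have step: "\<exists>u'. distinct u' \<and> ?Q k u u'" if "distinct u" for k u
  proof -
    have "distinct (map (\<lambda>c. [:c:]) u)"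
      using that by (auto simp: distinct_map intro: inj_onI)
    from bij_extending_list[OF countable_int_poly infinite_int_poly this]
    obtain \<nu> where \<nu>: "bij \<nu>" "\<And>i. i < length u \<Longrightarrow> \<nu> i = [:u ! i:]"
      by (simp only: length_map nth_map) blast
    obtain b where b: "\<And>q. (\<forall>n<b. q n = group_name \<nu> n) \<Longrightarrow> P k q"
      using "open"[OF poly[OF \<nu>(1)]] by blast
    obtain w where w: "w \<noteq> []" "distinct (u @ w)"
      "\<And>\<mu> :: nat \<Rightarrow> int. bij \<mu> \<Longrightarrow> \<forall>i<length (u @ w). \<mu> i = (u @ w) ! i \<Longrightarrow>
        \<forall>n<b. group_name \<mu> n = group_name \<nu> n"
      using collapse_name[OF \<nu>, where b = b] by blast
    \<comment> \<open>Listing the integer coded by \<open>k\<close> makes the limit surjective; the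
      case distinction keeps the list distinct.\<close>
    define z where "z = (if int_decode k \<in> set (u @ w) then [] else [int_decode k])"
    have "P k (group_name \<mu>)" if "bij \<mu>" "\<forall>i<length (u @ w @ z). \<mu> i = (u @ w @ z) ! i" for \<mu>
      using that by (intro b w(3)) (auto simp: nth_append)
    then have "?Q k u (u @ w @ z)"
      using w(1) by (auto simp: z_def)
    moreover have "distinct (u @ w @ z)"
      using w(2) by (auto simp: z_def)
    ultimately show ?thesis
      by blast
  qed
  have "\<exists>u. \<forall>k. distinct (u k) \<and> ?Q k (u k) (u (Suc k))"
  proof (rule dependent_nat_choice)
    show "\<exists>u :: int list. distinct u"
      by (rule exI[of _ "[]"]) simp
  qed (rule step)
  then obtain u where u: "\<And>k. distinct (u k)" "\<And>k. ?Q k (u k) (u (Suc k))"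
    by blast
  have "\<exists>k. x \<in> set (u k)" for x
    using u(2)[of "int_encode x"] by (intro exI[of _ "Suc (int_encode x)"]) simp
  then obtain \<mu> where \<mu>: "bij \<mu>" "\<And>k i. i < length (u k) \<Longrightarrow> \<mu> i = u k ! i"
    by (rule bij_limit_of_lists[rotated 2]) (use u in blast)+
  have "\<forall>k. P k (group_name \<mu>)"
    using u(2) \<mu> by blast
  with \<mu>(1) show ?thesis
    by (rule that)
qed

subsection \<open>The two instances of the problem\<close>

text \<open>Coefficient sequences are exactly the finitely supported functions, and the topmost
  difference of two of them is at the degree of the difference polynomial, whose leading coefficient
  decides the order.\<close>

lemma has_order_type_poly:
  fixes \<nu> :: "nat \<Rightarrow> int poly"
  assumes "bij \<nu>"
  shows "has_order_type {(i, j). \<nu> i \<le> \<nu> j} (int_power natLeq)"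
proof -
  have carrier: "range coeff = int_power_carrier natLeq"
  proof
    show "range coeff \<subseteq> int_power_carrier natLeq"
      using MOST_coeff_eq_0 by (auto simp: int_power_carrier_def Field_natLeq eventually_cofinite)
    show "int_power_carrier natLeq \<subseteq> range coeff"
    proof
      fix f assume "f \<in> int_power_carrier natLeq"
      then have "coeff (Abs_poly f) = f"
        by (intro Abs_poly_inverse) (simp add: int_power_carrier_def eventually_cofinite)
      then show "f \<in> range coeff"
        by (metis rangeI)
    qed
  qed
  have "bij_betw coeff UNIV (int_power_carrier natLeq)"
    by (auto simp: bij_betw_def carrier coeff_inject intro: injI)
  from bij_betw_trans[OF assms this] have "bij_betw (coeff \<circ> \<nu>) UNIV (int_power_carrier natLeq)" .
  moreover have "(coeff p, coeff q) \<in> int_power natLeq" if "p \<le> q" for p q :: "int poly"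
  proof (cases "p = q")
    case False
    then have "0 < coeff (q - p) (degree (q - p))"
      using that by (simp add: less_eq_poly_def pos_poly_def)
    moreover have "y \<le> degree (q - p)" if "coeff p y \<noteq> coeff q y" for y
      using that by (intro le_degree) simp
    ultimately have "int_power_less natLeq (coeff p) (coeff q)"
      unfolding int_power_less_def Field_natLeq
      by (intro bexI[of _ "degree (q - p)"]) (auto simp: natLeq_def)
    then show ?thesis
      using carrier by (auto simp: int_power_def)
  qed (use carrier in \<open>auto simp: int_power_def\<close>)
  moreover have "Field {(i, j). \<nu> i \<le> \<nu> j} = UNIV"
    by (auto simp: Field_def)
  ultimately show ?thesis
    unfolding has_order_type_def Field_int_power by (intro exI[of _ "coeff \<circ> \<nu>"]) auto
qed

lemma has_order_type_int:
  fixes \<nu> :: "nat \<Rightarrow> int"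
  assumes "bij \<nu>"
  shows "has_order_type {(i, j). \<nu> i \<le> \<nu> j} (int_power {(0 :: nat, 0)})"
proof -
  let ?r = "{(0 :: nat, 0 :: nat)}"
  define h :: "int \<Rightarrow> nat \<Rightarrow> int" where "h z = (\<lambda>x. if x = 0 then z else 0)" for z
  have carrier: "h z \<in> int_power_carrier ?r" for z
    by (auto simp: int_power_carrier_def h_def)
  have "bij_betw h UNIV (int_power_carrier ?r)"
    by (rule bij_betw_byWitness[where f' = "\<lambda>f. f 0"])
      (auto simp: int_power_carrier_def h_def fun_eq_iff split: if_splits)
  from bij_betw_trans[OF assms this] have "bij_betw (h \<circ> \<nu>) UNIV (int_power_carrier ?r)" .
  moreover have "(h a, h b) \<in> int_power ?r" if "a \<le> b" for a b
    using that carrier by (cases "a = b") (auto simp: int_power_def int_power_less_def h_def)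
  moreover have "Field {(i, j). \<nu> i \<le> \<nu> j} = UNIV"
    by (auto simp: Field_def)
  ultimately show ?thesis
    unfolding has_order_type_def Field_int_power by (intro exI[of _ "h \<circ> \<nu>"]) auto
qed

text \<open>Copies carry strict orders, hence the removal of the diagonal. This copy witnesses that
  an instance has a solution.\<close>

lemma is_copy_self:
  fixes r :: "nat rel"
  assumes "Well_order r"
  shows "is_copy r (Field r, r - Id)"
proof -
  have eq: "r - Id \<union> Id_on (Field r) = r"
    using assms by (auto simp: order_on_defs refl_on_def)
  show ?thesis
    unfolding is_copy_def using assms ordIso_reflexive[OF assms]
    by (auto simp: eq irrefl_def intro: FieldI1 FieldI2)
qed

lemma in_problem_dom:
  assumes "ordered_group_rep p = Some G" "Well_order (r :: nat rel)" "has_order_type (leq G) (int_power r)"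
  shows "G \<in> problem_dom OG_to_alpha0"
  using assms is_copy_self[OF assms(2)]
  by (auto simp: problem_dom_def OG_to_alpha0_def intro: ranI)

section \<open>Refuting a reduction with a generic name\<close>

theorem corollary2p34:
  shows "\<not> OG_to_alpha0 \<le>\<^sub>W choice_nat"
proof
  assume "OG_to_alpha0 \<le>\<^sub>W choice_nat"
  then obtain \<Phi> \<Psi> where comp: "computable \<Phi>" "computable \<Psi>" and red:
    "\<And>p G. ordered_group_rep p = Some G \<Longrightarrow> G \<in> problem_dom OG_to_alpha0 \<Longrightarrow>
      \<exists>p' Z. \<Phi> p = Some p' \<and> closed_nat_rep p' = Some Z \<and> Z \<in> problem_dom choice_nat \<and>
        (\<forall>q w. nat_rep q = Some w \<and> w \<in> Z \<longrightarrow>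
          (\<exists>r y. \<Psi> (interleave p q) = Some r \<and> strict_rel_rep r = Some y \<and>
            y \<in> solutions OG_to_alpha0 G))"
    unfolding weihrauch_le_def by (fastforce simp: OG_to_alpha0_def choice_nat_def)
  obtain e where e: "\<And>p q n. \<Phi> p = Some q \<Longrightarrow> computes p e [n] (q n)"
    using comp(1) unfolding computable_def by blast
  obtain d where d: "\<And>p q n. \<Psi> p = Some q \<Longrightarrow> computes p d [n] (q n)"
    using comp(2) unfolding computable_def by blast
  \<comment> \<open>The constant sequence is a name of \<open>n\<close>, and the even positions of
    \<open>r\<close> code the universe \<open>A\<close> of the copy.\<close>
  have red': "\<exists>p'. \<Phi> p = Some p' \<and> (\<exists>n. Suc n \<notin> range p') \<and>
      (\<forall>n. Suc n \<notin> range p' \<longrightarrow> (\<exists>r A S \<beta>. \<Psi> (interleave p (\<lambda>_. n)) = Some r \<and>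
        A = {a. r (2 * a) = 1} \<and> Well_order (\<beta> :: nat rel) \<and>
        has_order_type (leq G) (int_power \<beta>) \<and> is_copy \<beta> (A, S)))"
    if G: "ordered_group_rep p = Some G" "G \<in> problem_dom OG_to_alpha0" for p G
  proof -
    obtain p' Z where p': "\<Phi> p = Some p'" "closed_nat_rep p' = Some Z" "Z \<in> problem_dom choice_nat"
      and Z: "\<And>q w. nat_rep q = Some w \<Longrightarrow> w \<in> Z \<Longrightarrow>
          (\<exists>r y. \<Psi> (interleave p q) = Some r \<and> strict_rel_rep r = Some y \<and>
            y \<in> solutions OG_to_alpha0 G)"
      using red[OF G] by blast
    have Z_eq: "Z = {n. Suc n \<notin> range p'}"
      using p'(2) by (simp add: closed_nat_rep_def)
    moreover have "\<exists>n. n \<in> Z"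
      using p'(3) by (auto simp: problem_dom_def choice_nat_def)
    moreover have "\<exists>r A S \<beta>. \<Psi> (interleave p (\<lambda>_. n)) = Some r \<and>
        A = {a. r (2 * a) = 1} \<and> Well_order (\<beta> :: nat rel) \<and>
        has_order_type (leq G) (int_power \<beta>) \<and> is_copy \<beta> (A, S)" if "n \<in> Z" for n
    proof -
      obtain r y where r: "\<Psi> (interleave p (\<lambda>_. n)) = Some r" "strict_rel_rep r = Some y"
        "y \<in> solutions OG_to_alpha0 G"
        using Z[of "\<lambda>_. n" n] \<open>n \<in> Z\<close> unfolding nat_rep_def by blast
      obtain A S where "y = (A, S)" "A = {a. r (2 * a) = 1}"
        using r(2) by (auto simp: strict_rel_rep_def set_rep_def left_def split: option.splits if_splits)
      then show ?thesis
        using r by (auto simp: OG_to_alpha0_def)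
    qed
    ultimately show ?thesis
      using p'(1) by auto
  qed
  \<comment> \<open>\<open>k\<close> codes a candidate \<open>n\<close> and a bound
    \<open>m\<close>. An output \<open>Suc n\<close> of \<open>e\<close> rejects \<open>n\<close>;
    an output 1 of \<open>d\<close> at position \<open>2 * a\<close> puts \<open>a\<close> into the
    copy. Being stated through \<open>computes\<close>, the requirement is open and makes sense for
    every oracle.\<close>
  define P where "P k p \<longleftrightarrow> (case prod_decode k of (n, m) \<Rightarrow> (\<exists>t. computes p e [t] (Suc n)) \<or>
    (\<exists>a>m. computes (interleave p (\<lambda>_. n)) d [2 * a] 1))" for k p
  obtain \<mu> :: "nat \<Rightarrow> int" where \<mu>: "bij \<mu>" "\<forall>k. P k (group_name \<mu>)"
  proof (rule generic_int_name)
    fix k p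
    assume "P k p"
    obtain n m where nm: "prod_decode k = (n, m)"
      by fastforce
    from \<open>P k p\<close> consider t where "computes p e [t] (Suc n)" |
      a where "a > m" "computes (interleave p (\<lambda>_. n)) d [2 * a] 1"
      unfolding P_def nm by auto
    then show "\<exists>b. \<forall>q. (\<forall>n<b. q n = p n) \<longrightarrow> P k q"
    proof cases
      case 1
      then show ?thesis
        using computes_use[OF 1] unfolding P_def nm by simp blast
    next
      case 2
      obtain b where b: "\<And>q. (\<forall>i<b. q i = interleave p (\<lambda>_. n) i) \<Longrightarrow> computes q d [2 * a] 1"
        using computes_use[OF 2(2)] by blast
      have "P k q" if "\<forall>i<b. q i = p i" for q
      proof -
        have "computes (interleave q (\<lambda>_. n)) d [2 * a] 1"
          using that by (intro b allI impI interleave_cong[where b = b]) auto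
        then show ?thesis
          using 2(1) unfolding P_def nm by auto
      qed
      then show ?thesis
        by blast
    qed
  next
    fix k and \<nu> :: "nat \<Rightarrow> int poly"
    assume \<nu>: "bij \<nu>"
    obtain n m where nm: "prod_decode k = (n, m)"
      by fastforce
    obtain G where G: "ordered_group_rep (group_name \<nu>) = Some G" "leq G = {(i, j). \<nu> i \<le> \<nu> j}"
      using ordered_group_rep_group_name[OF \<nu>] .
    have "G \<in> problem_dom OG_to_alpha0"
      using G has_order_type_poly[OF \<nu>] by (intro in_problem_dom[OF G(1) natLeq_Well_order]) simp
    from red'[OF G(1) this] obtain p' where p': "\<Phi> (group_name \<nu>) = Some p'" and
      *: "\<And>n. Suc n \<notin> range p' \<Longrightarrow> (\<exists>r A S \<beta>. \<Psi> (interleave (group_name \<nu>) (\<lambda>_. n)) = Some r \<and>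
        A = {a. r (2 * a) = 1} \<and> Well_order (\<beta> :: nat rel) \<and>
        has_order_type (leq G) (int_power \<beta>) \<and> is_copy \<beta> (A, S))"
      by blast
    show "P k (group_name \<nu>)"
    proof (cases "Suc n \<in> range p'")
      case True
      then obtain t where "p' t = Suc n"
        by auto
      then show ?thesis
        using e[OF p', of t] unfolding P_def nm by auto
    next
      case False
      obtain r A S and \<beta> :: "nat rel" where r: "\<Psi> (interleave (group_name \<nu>) (\<lambda>_. n)) = Some r"
        "A = {a. r (2 * a) = 1}" "Well_order \<beta>" "has_order_type (leq G) (int_power \<beta>)" "is_copy \<beta> (A, S)"
        using *[OF False] by blast
      have "infinite A"
        using order_type_poly_infinite[OF \<nu> r(3)] r(4,5) G(2) is_copy_finite_iff by metis
      then obtain a where "a > m" "a \<in> A"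
        by (meson infinite_nat_iff_unbounded)
      then show ?thesis
        using d[OF r(1), of "2 * a"] unfolding P_def nm r(2) by auto
    qed
  qed
  obtain G where G: "ordered_group_rep (group_name \<mu>) = Some G" "leq G = {(i, j). \<mu> i \<le> \<mu> j}"
    using ordered_group_rep_group_name[OF \<mu>(1)] .
  have "Well_order {(0 :: nat, 0)}"
    by (auto simp: order_on_defs refl_on_def Field_def trans_def antisym_def total_on_def wf_def)
  then have "G \<in> problem_dom OG_to_alpha0"
    using G has_order_type_int[OF \<mu>(1)] by (intro in_problem_dom[OF G(1)]) simp_all
  from red'[OF G(1) this] obtain p' n where p': "\<Phi> (group_name \<mu>) = Some p'" and n: "Suc n \<notin> range p'"
    and "\<exists>r A S \<beta>. \<Psi> (interleave (group_name \<mu>) (\<lambda>_. n)) = Some r \<and>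
      A = {a. r (2 * a) = 1} \<and> Well_order (\<beta> :: nat rel) \<and>
      has_order_type (leq G) (int_power \<beta>) \<and> is_copy \<beta> (A, S)"
    by blast
  then obtain r A S and \<beta> :: "nat rel" where r: "\<Psi> (interleave (group_name \<mu>) (\<lambda>_. n)) = Some r"
    "A = {a. r (2 * a) = 1}" "Well_order \<beta>" "has_order_type (leq G) (int_power \<beta>)" "is_copy \<beta> (A, S)"
    by blast
  have "finite A"
    using order_type_int_finite[OF \<mu>(1) r(3)] r(4,5) G(2) is_copy_finite_iff by metis
  then obtain m where m: "\<And>a. a \<in> A \<Longrightarrow> a \<le> m"
    using finite_nat_set_iff_bounded_le by auto
  \<comment> \<open>\<open>n\<close> is not rejected and \<open>m\<close> bounds the finite copy, so
    both alternatives of this requirement fail.\<close>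
  have "P (prod_encode (n, m)) (group_name \<mu>)"
    using \<mu>(2) by blast
  then consider t where "computes (group_name \<mu>) e [t] (Suc n)" |
    a where "a > m" "computes (interleave (group_name \<mu>) (\<lambda>_. n)) d [2 * a] 1"
    unfolding P_def by auto
  then show False
  proof cases
    case 1
    then have "p' t = Suc n"
      using e[OF p'] computes_deterministic by blast
    then show False
      using n by (metis rangeI)
  next
    case 2
    then have "r (2 * a) = 1"
      using d[OF r(1)] computes_deterministic by blast
    then show False
      using m[of a] 2(1) r(2) by simp
  qed
qed

end
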